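(* Let $n\ge 2$ and $0<\epsilon<1$. For the inverse riffle shuffle on a deck of $n$ cards, the mixing time $t_{\mathrm{mix}}(\epsilon)$ for the identity of the top card satisfies $t_{\mathrm{mix}}(\epsilon)\le \log_2(n-1)-\log_2(\epsilon)$.
   Context: One step of the inverse riffle shuffle on a deck of $n$ cards labelled $1,\dots,n$: assign to each card an independent uniformly random bit in $\{0,1\}$, then sort the deck by these bits, breaking ties by the previous order of the cards. For a statistic $f$ (a function of the deck order), the stationary distribution of $f$ is the distribution of $f$ on a uniformly random deck order. The mixing time $t_{\mathrm{mix}}(\epsilon)$ for $f$ is the number of steps needed so that, for every starting order, the distribution of $f$ is within $\epsilon$ of its stationary distribution in total variation distance; a bound $t_{\mathrm{mix}}(\epsilon)\le T$ with $T$ real means that this holds after $t$ steps for every nonnegative integer $t\ge T$. *)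

theory Defs
  imports "HOL-Probability.Probability" "HOL-Combinatorics.Multiset_Permutations"
begin

text \<open>A deck order is a list of the cards \<open>1, \<dots>, n\<close>; the head of the list is the top card.\<close>

definition decks :: "nat \<Rightarrow> nat list set" where
  "decks n = permutations_of_set {1..n}"

definition random_bits :: "nat \<Rightarrow> (nat \<Rightarrow> nat) pmf" where
  "random_bits n = Pi_pmf {1..n} 0 (\<lambda>_. pmf_of_set {0, 1})"

text \<open>Since \<^const>\<open>sort_key\<close> is stable (fact \<open>sort_key_stable\<close>), cards with equal bits
  keep their previous order, and the cards with bit \<open>0\<close> end up on top.\<close>

definition inverse_riffle_step :: "nat \<Rightarrow> nat list \<Rightarrow> nat list pmf" where
  "inverse_riffle_step n d = map_pmf (\<lambda>b. sort_key b d) (random_bits n)"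

primrec inverse_riffle :: "nat \<Rightarrow> nat \<Rightarrow> nat list \<Rightarrow> nat list pmf" where
  "inverse_riffle n 0 d = return_pmf d"
| "inverse_riffle n (Suc t) d = bind_pmf (inverse_riffle n t d) (inverse_riffle_step n)"

definition stationary_distribution :: "nat \<Rightarrow> (nat list \<Rightarrow> 'a) \<Rightarrow> 'a pmf" where
  "stationary_distribution n f = map_pmf f (pmf_of_set (decks n))"

definition tv_dist :: "'a pmf \<Rightarrow> 'a pmf \<Rightarrow> real" where
  "tv_dist p q = (SUP A. \<bar>measure_pmf.prob p A - measure_pmf.prob q A\<bar>)"

text \<open>The bound \<open>t\<^sub>m\<^sub>i\<^sub>x(\<epsilon>) \<le> T\<close> for the statistic \<open>f\<close>. As \<open>T\<close> is real and need not be an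
  integer, the bound means that every integer number of steps \<open>t \<ge> T\<close> suffices.\<close>

definition mixing_time_le :: "nat \<Rightarrow> (nat list \<Rightarrow> 'a) \<Rightarrow> real \<Rightarrow> real \<Rightarrow> bool" where
  "mixing_time_le n f \<epsilon> T \<longleftrightarrow>
     (\<forall>t::nat. T \<le> real t \<longrightarrow>
        (\<forall>d\<in>decks n.
           tv_dist (map_pmf f (inverse_riffle n t d)) (stationary_distribution n f) \<le> \<epsilon>))"

definition top_card :: "nat list \<Rightarrow> nat" where
  "top_card d = hd d"

end

theory Submission
  imports Defs
begin

text \<open>
  Read the bits that a card receives in \<open>t\<close> steps as a binary number, the bit of the last
  step being the most significant one. Since every step sorts stably, the deck after
  \<open>t\<close> steps is the initial deck sorted stably by these labels, which are independent and uniform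
  on \<open>{0, \<dots>, N - 1}\<close> with \<open>N = 2\<^sup>t\<close> (lemma \<open>inverse_riffle_eq_sort_key\<close>).

  Let \<open>p\<^sub>a\<close> be the probability that card \<open>a\<close> is on top. How ties are broken depends on the initial
  order, but in any case \<open>s \<le> p\<^sub>a \<le> w\<close>, where \<open>s\<close> is the probability that the label of \<open>a\<close> is smaller
  than all others and \<open>w\<close> the probability that it is at most all others. By symmetry \<open>s\<close> and
  \<open>w\<close> are the same for all cards. Moreover \<open>w - s = 1 / N\<close>: raising the label of \<open>a\<close> by one maps the
  labellings in which \<open>a\<close> is the strict minimum bijectively onto those in which \<open>a\<close> is a weak
  minimum with a positive label, so only the labellings that give \<open>a\<close> the label \<open>0\<close> are missed
  (lemma \<open>card_weak_min_labellings\<close>).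

  The numbers \<open>p\<^sub>a\<close> lie in the interval \<open>[s, w]\<close> of length \<open>1 / N\<close>, and so does their average \<open>1 / n\<close>.
  Hence \<open>\<bar>p\<^sub>a - 1 / n\<bar> \<le> 1 / N\<close> for every \<open>a\<close>. An event that contains all cards has probability one
  under both distributions, and every other event contains at most \<open>n - 1\<close> cards, so the total
  variation distance is at most \<open>(n - 1) / 2\<^sup>t\<close>. This is at most \<open>\<epsilon>\<close> as soon as
  \<open>t \<ge> log 2 (n - 1) - log 2 \<epsilon>\<close>.
\<close>

section \<open>Iterated stable sorting\<close>

lemma sorted_lexicographic:
  fixes f :: "'a \<Rightarrow> 'b::linorder" and g :: "'a \<Rightarrow> 'c::linorder" and h :: "'a \<Rightarrow> 'd::linorder"
  assumes "sorted (map f xs)"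
    and "\<And>k. sorted (map g (filter (\<lambda>x. f x = k) xs))"
    and "\<And>x y. x \<in> set xs \<Longrightarrow> y \<in> set xs \<Longrightarrow> h x \<le> h y \<longleftrightarrow> f x < f y \<or> f x = f y \<and> g x \<le> g y"
  shows "sorted (map h xs)"
  using assms
proof (induction xs)
  case (Cons x xs)
  have "h x \<le> h y" if y: "y \<in> set xs" for y
  proof -
    have "f x \<le> f y"
      using Cons.prems(1) y by simp
    moreover have "g x \<le> g y" if "f x = f y"
      using Cons.prems(2)[of "f x"] y that by simp
    ultimately show ?thesis
      using Cons.prems(3)[of x y] y by auto
  qed
  moreover have "sorted (map h xs)"
  proof (rule Cons.IH)
    show "sorted (map g (filter (\<lambda>x. f x = k) xs))" for k
      using Cons.prems(2)[of k] by (simp split: if_splits)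
  qed (use Cons.prems in auto)
  ultimately show ?case by simp
qed simp

text \<open>
  Radix sort: sorting by the less significant key \<open>g\<close> and then stably by \<open>f\<close> amounts to one stable
  sort by any key \<open>h\<close> that encodes the lexicographic order of \<open>(f, g)\<close>. Elements with equal \<open>h\<close>
  agree in both keys, so neither sort changes their relative order.
\<close>

lemma sort_key_sort_key:
  fixes f :: "'a \<Rightarrow> 'b::linorder" and g :: "'a \<Rightarrow> 'c::linorder" and h :: "'a \<Rightarrow> 'd::linorder"
  assumes lex: "\<And>x y. x \<in> set xs \<Longrightarrow> y \<in> set xs \<Longrightarrow>
    h x \<le> h y \<longleftrightarrow> f x < f y \<or> f x = f y \<and> g x \<le> g y"
  shows "sort_key f (sort_key g xs) = sort_key h xs"
proof (rule sym, rule properties_for_sort_key)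
  let ?ys = "sort_key f (sort_key g xs)"
  show "mset ?ys = mset xs" by simp
  show "filter (\<lambda>x. h k = h x) ?ys = filter (\<lambda>x. h k = h x) xs" if k: "k \<in> set ?ys" for k
  proof -
    have split: "h k = h x \<longleftrightarrow> g x = g k \<and> f x = f k" if x: "x \<in> set xs" for x
    proof -
      have "k \<in> set xs"
        using k by simp
      have "h k = h x \<longleftrightarrow> h k \<le> h x \<and> h x \<le> h k"
        by (rule order_eq_iff)
      also have "\<dots> \<longleftrightarrow> g x = g k \<and> f x = f k"
        unfolding lex[OF \<open>k \<in> set xs\<close> x] lex[OF x \<open>k \<in> set xs\<close>] by auto
      finally show ?thesis .
    qed
    have "filter (\<lambda>x. h k = h x) ?ys = filter (\<lambda>x. g x = g k \<and> f x = f k) ?ys"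
      by (rule filter_cong) (simp_all add: split)
    also have "\<dots> = filter (\<lambda>x. g x = g k) (filter (\<lambda>x. f x = f k) ?ys)"
      by (simp add: conj_commute)
    also have "\<dots> = filter (\<lambda>x. f x = f k) (filter (\<lambda>x. g x = g k) (sort_key g xs))"
      unfolding sort_key_stable[of f] by (simp add: conj_commute)
    also have "\<dots> = filter (\<lambda>x. g x = g k \<and> f x = f k) xs"
      unfolding sort_key_stable[of g] by (simp add: conj_commute)
    also have "\<dots> = filter (\<lambda>x. h k = h x) xs"
      by (rule filter_cong) (simp_all add: split)
    finally show ?thesis .
  qed
  show "sorted (map h ?ys)"
  proof (rule sorted_lexicographic)
    show "sorted (map g (filter (\<lambda>x. f x = k) ?ys))" for k
      unfolding sort_key_stable by (intro sorted_filter) simp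
  qed (use lex in auto)
qed

section \<open>The shuffled deck as a deck sorted by random labels\<close>

text \<open>
  Labels outside of \<open>A\<close> are fixed to be \<open>0\<close>, as in \<^const>\<open>random_bits\<close>, so that the set is finite
  and the uniform distribution on it is the distribution of independent uniform labels.
\<close>

definition labellings :: "'a set \<Rightarrow> nat \<Rightarrow> ('a \<Rightarrow> nat) set" where
  "labellings A N = PiE_dflt A 0 (\<lambda>_. {..<N})"

lemma finite_labellings [simp]: "finite A \<Longrightarrow> finite (labellings A N)"
  unfolding labellings_def by auto

lemma card_labellings: "finite A \<Longrightarrow> card (labellings A N) = N ^ card A"
  unfolding labellings_def by (simp add: card_PiE_dflt)

lemma labellings_nonempty [simp]: "0 < N \<Longrightarrow> labellings A N \<noteq> {}"
  unfolding labellings_def by auto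

text \<open>
  Independent uniform leading digits (in base \<open>m\<close>) and remainders below \<open>N\<close> combine to uniform labels
  below \<open>m * N\<close>, because division with remainder by \<open>N\<close> recovers both.
\<close>

lemma bij_betw_leading_digit:
  assumes "0 < N"
  shows "bij_betw (\<lambda>(b, X) i. b i * N + X i) (labellings A m \<times> labellings A N) (labellings A (m * N))"
proof (rule bij_betw_byWitness[where f' = "\<lambda>Y. (\<lambda>i. Y i div N, \<lambda>i. Y i mod N)"])
  show "(\<lambda>(b, X) i. b i * N + X i) ` (labellings A m \<times> labellings A N) \<subseteq> labellings A (m * N)"
  proof clarify
    fix b X assume bX: "b \<in> labellings A m" "X \<in> labellings A N"
    have "b i * N + X i < m * N" if "i \<in> A" for i
    proof -
      have "b i * N + X i < Suc (b i) * N"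
        using bX that by (simp add: labellings_def PiE_dflt_def)
      also have "\<dots> \<le> m * N"
        using bX that by (intro mult_le_mono1) (simp add: labellings_def PiE_dflt_def Suc_le_eq)
      finally show ?thesis .
    qed
    then show "(\<lambda>i. b i * N + X i) \<in> labellings A (m * N)"
      using bX by (simp add: labellings_def PiE_dflt_def)
  qed
  show "\<forall>p\<in>labellings A m \<times> labellings A N.
    (\<lambda>i. (case p of (b, X) \<Rightarrow> \<lambda>i. b i * N + X i) i div N,
     \<lambda>i. (case p of (b, X) \<Rightarrow> \<lambda>i. b i * N + X i) i mod N) = p"
  proof clarify
    fix b X assume bX: "b \<in> labellings A m" "X \<in> labellings A N"
    then have "X i < N" for i
      using assms by (cases "i \<in> A") (auto simp: labellings_def PiE_dflt_def)
    then show "(\<lambda>i. (b i * N + X i) div N) = b \<and> (\<lambda>i. (b i * N + X i) mod N) = X"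
      using assms by auto
  qed
qed (use assms in \<open>auto simp: labellings_def PiE_dflt_def less_mult_imp_div_less\<close>)

text \<open>
  A further step sorts a deck that is already sorted by \<open>X\<close>, so its bits \<open>b\<close> decide first and \<open>X\<close> only
  breaks ties. The bit of the new step therefore enters the label as its leading digit.
\<close>

lemma inverse_riffle_eq_sort_key:
  assumes d: "d \<in> decks n"
  shows "inverse_riffle n t d = map_pmf (\<lambda>X. sort_key X d) (pmf_of_set (labellings {1..n} (2 ^ t)))"
proof (induction t)
  case 0
  have "labellings {1..n} (2 ^ 0) = {\<lambda>_. 0}"
    by (auto simp: labellings_def PiE_dflt_def fun_eq_iff)
  then show ?case
    by (simp add: pmf_of_set_singleton sort_key_const)
next
  case (Suc t)
  let ?L = "labellings {1..n}" and ?join = "\<lambda>(b, X) i. b i * 2 ^ t + X i :: nat"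
  have bits: "random_bits n = pmf_of_set (?L 2)"
    unfolding random_bits_def labellings_def
    by (subst Pi_pmf_of_set) (auto simp: lessThan_Suc numeral_2_eq_2 insert_commute)
  have "inverse_riffle n (Suc t) d =
      map_pmf (\<lambda>(b, X). sort_key b (sort_key X d)) (pair_pmf (pmf_of_set (?L 2)) (pmf_of_set (?L (2 ^ t))))"
    by (subst pair_commute_pmf)
      (simp add: Suc inverse_riffle_step_def[abs_def] bits map_pmf_def pair_pmf_def bind_assoc_pmf bind_return_pmf)
  also have "\<dots> = map_pmf (\<lambda>X. sort_key X d)
      (map_pmf ?join (pair_pmf (pmf_of_set (?L 2)) (pmf_of_set (?L (2 ^ t)))))"
    unfolding pmf.map_comp
  proof (rule map_pmf_cong[OF refl], clarify)
    fix b X assume "(b, X) \<in> set_pmf (pair_pmf (pmf_of_set (?L 2)) (pmf_of_set (?L (2 ^ t))))"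
    then have "X \<in> ?L (2 ^ t)"
      by simp
    then have X: "X i < 2 ^ t" for i
      by (cases "i \<in> {1..n}") (auto simp: labellings_def PiE_dflt_def)
    have "sort_key b (sort_key X d) = sort_key (\<lambda>i. b i * 2 ^ t + X i) d"
    proof (rule sort_key_sort_key)
      fix x y
      have *: "b u * 2 ^ t + X u < b v * 2 ^ t + X v" if "b u < b v" for u v
      proof -
        have "b u * 2 ^ t + X u < Suc (b u) * 2 ^ t"
          using X by simp
        also have "\<dots> \<le> b v * 2 ^ t"
          using that by (intro mult_le_mono1) simp
        finally show ?thesis by simp
      qed
      show "b x * 2 ^ t + X x \<le> b y * 2 ^ t + X y \<longleftrightarrow> b x < b y \<or> b x = b y \<and> X x \<le> X y"
        using *[of x y] *[of y x] by (cases "b x" "b y" rule: linorder_cases) auto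
    qed
    then show "sort_key b (sort_key X d) = ((\<lambda>X. sort_key X d) \<circ> ?join) (b, X)"
      by simp
  qed
  also have "pair_pmf (pmf_of_set (?L 2)) (pmf_of_set (?L (2 ^ t))) = pmf_of_set (?L 2 \<times> ?L (2 ^ t))"
    by (rule pmf_eqI) (auto simp: pmf_pair indicator_def)
  also have "map_pmf ?join \<dots> = pmf_of_set (?L (2 ^ Suc t))"
    using bij_betw_leading_digit[of "2 ^ t" "{1..n}" 2]
    by (subst map_pmf_of_set_bij_betw) auto
  finally show ?case .
qed

section \<open>The top card of a uniformly random deck\<close>

lemma stationary_top_card:
  assumes "0 < n"
  shows "stationary_distribution n top_card = pmf_of_set {1..n}"
  unfolding stationary_distribution_def decks_def using assms
  by (subst random_permutation_of_set) (auto simp: map_bind_pmf top_card_def bind_return_pmf')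

section \<open>Labellings that are minimal at a given point\<close>

definition strict_min_labellings :: "'a set \<Rightarrow> nat \<Rightarrow> 'a \<Rightarrow> ('a \<Rightarrow> nat) set" where
  "strict_min_labellings A N a = {X \<in> labellings A N. \<forall>k\<in>A - {a}. X a < X k}"

definition weak_min_labellings :: "'a set \<Rightarrow> nat \<Rightarrow> 'a \<Rightarrow> ('a \<Rightarrow> nat) set" where
  "weak_min_labellings A N a = {X \<in> labellings A N. \<forall>k\<in>A - {a}. X a \<le> X k}"

text \<open>
  Increasing the value at \<open>a\<close> by one turns strict minima into weak minima. The new value is still
  below \<open>N\<close>, since it is at most the value at another point \<open>b\<close>. The weak minima that are not reached
  are those with value \<open>0\<close> at \<open>a\<close>, where the remaining values are arbitrary; this gives the
  power of \<open>N\<close>.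
\<close>

lemma card_weak_min_labellings:
  assumes "finite A" "a \<in> A" "b \<in> A" "b \<noteq> a" "0 < N"
  shows "card (weak_min_labellings A N a) = card (strict_min_labellings A N a) + N ^ (card A - 1)"
proof -
  let ?W = "weak_min_labellings A N a" and ?S = "strict_min_labellings A N a"
  let ?Z = "{X \<in> labellings A N. X a = 0}"
  have 1: "bij_betw (\<lambda>X. X(a := Suc (X a))) ?S {X \<in> ?W. 0 < X a}"
  proof (rule bij_betw_byWitness[where f' = "\<lambda>X. X(a := X a - 1)"])
    show "(\<lambda>X. X(a := Suc (X a))) ` ?S \<subseteq> {X \<in> ?W. 0 < X a}"
    proof clarify
      fix X assume X: "X \<in> ?S"
      have "Suc (X a) \<le> X b" "X b < N"
        using X assms by (auto simp: strict_min_labellings_def labellings_def PiE_dflt_def Suc_le_eq)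
      then have "X(a := Suc (X a)) \<in> labellings A N"
        using X assms by (auto simp: strict_min_labellings_def labellings_def PiE_dflt_def)
      then show "X(a := Suc (X a)) \<in> ?W \<and> 0 < (X(a := Suc (X a))) a"
        using X by (auto simp: strict_min_labellings_def weak_min_labellings_def Suc_le_eq)
    qed
    show "(\<lambda>X. X(a := X a - 1)) ` {X \<in> ?W. 0 < X a} \<subseteq> ?S"
    proof clarify
      fix X assume X: "X \<in> ?W" "0 < X a"
      have "X(a := X a - 1) \<in> labellings A N"
        using X assms(2) by (auto simp: weak_min_labellings_def labellings_def PiE_dflt_def less_imp_diff_less)
      then show "X(a := X a - 1) \<in> ?S"
        using X by (force simp: strict_min_labellings_def weak_min_labellings_def)
    qed
  qed auto
  have "?Z = labellings (A - {a}) N"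
    using assms by (auto simp: labellings_def PiE_dflt_def)
  then have 2: "card ?Z = N ^ (card A - 1)"
    using assms by (simp add: card_labellings)
  have finite_W: "finite {X \<in> ?W. 0 < X a}" and finite_Z: "finite ?Z"
    using assms(1) by (auto simp: weak_min_labellings_def)
  have "?W = {X \<in> ?W. 0 < X a} \<union> ?Z"
    by (auto simp: weak_min_labellings_def)
  then have "card ?W = card {X \<in> ?W. 0 < X a} + card ?Z"
    using finite_W finite_Z card_Un_disjoint[of "{X \<in> ?W. 0 < X a}" ?Z] by force
  then show ?thesis
    using 2 bij_betw_same_card[OF 1] by simp
qed

text \<open>
  The two sets correspond to each other by exchanging the values at \<open>a\<close> and \<open>b\<close>. With
  \<open>card_weak_min_labellings\<close>, the same independence of the point holds for weak minima.
\<close>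

lemma card_strict_min_labellings_eq:
  assumes "finite A" "a \<in> A" "b \<in> A"
  shows "card (strict_min_labellings A N a) = card (strict_min_labellings A N b)"
proof (rule bij_betw_same_card)
  let ?s = "Transposition.transpose a b"
  have swap: "X \<circ> Transposition.transpose x y \<in> strict_min_labellings A N y"
    if X: "X \<in> strict_min_labellings A N x" and "x \<in> A" "y \<in> A" for X x y
  proof -
    let ?t = "Transposition.transpose x y"
    have "X \<circ> ?t \<in> labellings A N"
      using that by (auto simp: strict_min_labellings_def labellings_def PiE_dflt_def
          Transposition.transpose_def)
    moreover have "X (?t y) < X (?t k)" if "k \<in> A - {y}" for k
    proof -
      have "?t k \<in> A - {x}"
        using that \<open>x \<in> A\<close> \<open>y \<in> A\<close> by (auto simp: Transposition.transpose_def)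
      then show ?thesis
        using X by (simp add: strict_min_labellings_def)
    qed
    ultimately show ?thesis
      by (simp add: strict_min_labellings_def)
  qed
  show "bij_betw (\<lambda>X. X \<circ> ?s) (strict_min_labellings A N a) (strict_min_labellings A N b)"
  proof (rule bij_betw_byWitness[where f' = "\<lambda>X. X \<circ> ?s"])
    show "(\<lambda>X. X \<circ> ?s) ` strict_min_labellings A N a \<subseteq> strict_min_labellings A N b"
      using swap assms by blast
    show "(\<lambda>X. X \<circ> ?s) ` strict_min_labellings A N b \<subseteq> strict_min_labellings A N a"
      using swap[of _ b a] assms by (auto simp: Transposition.transpose_commute[of b a])
  qed (simp_all add: comp_assoc)
qed

section \<open>The distribution of the top card after some steps\<close>

lemma hd_sort_key_minimal:
  fixes X :: "'a \<Rightarrow> 'b::linorder"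
  assumes "x \<in> set d"
  shows "X (hd (sort_key X d)) \<le> X x"
proof -
  have "sorted (map X (sort_key X d))" "x \<in> set (sort_key X d)"
    using assms by simp_all
  then show ?thesis
    by (cases "sort_key X d") auto
qed

text \<open>
  The top card is a card of minimal label. A card whose label is the strict minimum is therefore on
  top, whatever the initial order, and the label of the top card is always a weak minimum. The
  denominator \<open>2 ^ (t * n)\<close> is the number of all labellings.
\<close>

lemma pmf_top_card_bounds:
  fixes t :: nat
  assumes d: "d \<in> decks n" and a: "a \<in> {1..n}"
  defines "p \<equiv> map_pmf top_card (inverse_riffle n t d)"
  shows "real (card (strict_min_labellings {1..n} (2 ^ t) a)) / 2 ^ (t * n) \<le> pmf p a"
    and "pmf p a \<le> real (card (weak_min_labellings {1..n} (2 ^ t) a)) / 2 ^ (t * n)"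
proof -
  let ?A = "{1..n}" and ?N = "2 ^ t :: nat"
  have set_d: "set d = ?A"
    using d by (simp add: decks_def permutations_of_setD)
  have p: "pmf p a = real (card {X \<in> labellings ?A ?N. hd (sort_key X d) = a}) / 2 ^ (t * n)"
    unfolding p_def inverse_riffle_eq_sort_key[OF d]
    by (simp add: pmf.map_comp o_def top_card_def pmf_map measure_pmf_of_set card_labellings
        vimage_def Int_def power_mult)
  have "strict_min_labellings ?A ?N a \<subseteq> {X \<in> labellings ?A ?N. hd (sort_key X d) = a}"
  proof
    fix X assume X: "X \<in> strict_min_labellings ?A ?N a"
    have "sort_key X d \<noteq> []"
      using a set_d by (metis empty_iff list.set(1) set_sort)
    then have "hd (sort_key X d) \<in> ?A"
      using set_d hd_in_set by (metis set_sort)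
    moreover have "X (hd (sort_key X d)) \<le> X a"
      using a set_d by (simp add: hd_sort_key_minimal)
    ultimately show "X \<in> {X \<in> labellings ?A ?N. hd (sort_key X d) = a}"
      using X unfolding strict_min_labellings_def by (auto simp: not_less[symmetric])
  qed
  then show "real (card (strict_min_labellings ?A ?N a)) / 2 ^ (t * n) \<le> pmf p a"
    unfolding p by (intro divide_right_mono of_nat_mono card_mono) auto
  have "{X \<in> labellings ?A ?N. hd (sort_key X d) = a} \<subseteq> weak_min_labellings ?A ?N a"
    by (auto simp: weak_min_labellings_def set_d intro!: hd_sort_key_minimal)
  then show "pmf p a \<le> real (card (weak_min_labellings ?A ?N a)) / 2 ^ (t * n)"
    unfolding p by (intro divide_right_mono of_nat_mono card_mono) (auto simp: weak_min_labellings_def)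
qed

lemma set_pmf_top_card:
  assumes d: "d \<in> decks n" and "0 < n"
  shows "set_pmf (map_pmf top_card (inverse_riffle n t d)) \<subseteq> {1..n}"
proof -
  have set_d: "set d = {1..n}"
    using d by (simp add: decks_def permutations_of_setD)
  have "hd (sort_key X d) \<in> {1..n}" for X :: "nat \<Rightarrow> nat"
    using assms(2) set_d hd_in_set[of "sort_key X d"] by (metis atLeastAtMost_iff empty_iff le_refl less_eq_Suc_le One_nat_def list.set(1) set_sort)
  then show ?thesis
    by (auto simp: inverse_riffle_eq_sort_key[OF d] top_card_def)
qed

lemma average_in_interval:
  fixes p :: "'a \<Rightarrow> real"
  assumes "finite A" "A \<noteq> {}" "\<And>x. x \<in> A \<Longrightarrow> p x \<in> {l..u}" "sum p A = 1"
  shows "1 / real (card A) \<in> {l..u}"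
proof -
  have "real (card A) * l \<le> 1" "1 \<le> real (card A) * u"
    using assms sum_bounded_below[of A l p] sum_bounded_above[of A p u] by auto
  moreover have "0 < card A" using assms by (simp add: card_gt_0_iff)
  ultimately show ?thesis by (simp add: field_simps)
qed

text \<open>
  The bounds \<open>s\<close> and \<open>s + 1 / 2 ^ t\<close> do not depend on the card, and so the mean \<open>1 / n\<close> of the
  probabilities obeys them as well.
\<close>

lemma pmf_top_card_near_uniform:
  assumes d: "d \<in> decks n" and n: "2 \<le> n" and a: "a \<in> {1..n}"
  shows "\<bar>pmf (map_pmf top_card (inverse_riffle n t d)) a - 1 / real n\<bar> \<le> 1 / 2 ^ t"
proof -
  let ?A = "{1..n}" and ?N = "2 ^ t :: nat"
  define p where "p = pmf (map_pmf top_card (inverse_riffle n t d))"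
  define s where "s = real (card (strict_min_labellings ?A ?N 1)) / 2 ^ (t * n)"
  have p: "p i \<in> {s..s + 1 / 2 ^ t}" if i: "i \<in> ?A" for i
  proof -
    have strict: "card (strict_min_labellings ?A ?N i) = card (strict_min_labellings ?A ?N 1)"
      using i by (intro card_strict_min_labellings_eq) auto
    have weak: "card (weak_min_labellings ?A ?N i) = card (strict_min_labellings ?A ?N 1) + ?N ^ (n - 1)"
    proof -
      \<comment> \<open>Any second card will do; it exists because there are at least two.\<close>
      obtain j where "j \<in> ?A" "j \<noteq> i"
      proof
        show "(if i = 1 then 2 else 1) \<in> ?A" "(if i = 1 then 2 else 1) \<noteq> i"
          using n by auto
      qed
      then show ?thesis
        using card_weak_min_labellings[of ?A i j ?N] i strict by simp
    qed
    have "real (?N ^ (n - 1)) / 2 ^ (t * n) = 1 / 2 ^ t"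
      using n by (cases n) (simp_all add: power_mult power_add)
    then show ?thesis
      using pmf_top_card_bounds[OF d i, of t] unfolding strict weak p_def s_def by (simp add: add_divide_distrib)
  qed
  have "sum p ?A = 1"
    unfolding p_def using n by (intro sum_pmf_eq_1 set_pmf_top_card[OF d]) auto
  then have "1 / real n \<in> {s..s + 1 / 2 ^ t}"
    using average_in_interval[of ?A p s "s + 1 / 2 ^ t"] p n by simp
  then show ?thesis
    using p[OF a] unfolding p_def by auto
qed

section \<open>Total variation distance\<close>

text \<open>
  The factor is one less than the size of \<open>B\<close> because an event containing all of \<open>B\<close> has
  probability one under both distributions and contributes no difference.
\<close>

lemma tv_dist_le_if_pmf_close:
  assumes "finite B" "set_pmf p \<subseteq> B" "set_pmf q \<subseteq> B" "0 \<le> \<delta>"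
    and close: "\<And>x. x \<in> B \<Longrightarrow> \<bar>pmf p x - pmf q x\<bar> \<le> \<delta>"
  shows "tv_dist p q \<le> real (card B - 1) * \<delta>"
  unfolding tv_dist_def
proof (rule cSUP_least)
  fix A
  have prob: "measure_pmf.prob r A = sum (pmf r) (A \<inter> B)" if "set_pmf r \<subseteq> B" for r
    using that assms(1) measure_measure_pmf_finite[of "A \<inter> B" r]
      measure_Int_set_pmf[of r A] measure_Int_set_pmf[of r "A \<inter> B"]
    by (metis finite_Int inf.absorb_iff2 inf_assoc)
  show "\<bar>measure_pmf.prob p A - measure_pmf.prob q A\<bar> \<le> real (card B - 1) * \<delta>"
  proof (cases "B \<subseteq> A")
    case True
    then have "A \<inter> B = B" by auto
    then show ?thesis
      using assms by (simp add: prob sum_pmf_eq_1)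
  next
    case False
    then have "card (A \<inter> B) < card B"
      using assms(1) by (intro psubset_card_mono) auto
    have "\<bar>measure_pmf.prob p A - measure_pmf.prob q A\<bar> = \<bar>\<Sum>x\<in>A \<inter> B. pmf p x - pmf q x\<bar>"
      using assms by (simp add: prob sum_subtractf)
    also have "\<dots> \<le> (\<Sum>x\<in>A \<inter> B. \<delta>)"
      using close by (intro order.trans[OF sum_abs] sum_mono) auto
    also have "\<dots> \<le> real (card B - 1) * \<delta>"
      using \<open>card (A \<inter> B) < card B\<close> assms(4) by (auto intro!: mult_right_mono)
    finally show ?thesis .
  qed
qed simp

section \<open>The mixing time\<close>

theorem proposition27:
  fixes n :: nat and \<epsilon> :: real
  assumes "2 \<le> n" and "0 < \<epsilon>" and "\<epsilon> < 1"
  shows "mixing_time_le n top_card \<epsilon> (log 2 (real n - 1) - log 2 \<epsilon>)"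
  unfolding mixing_time_le_def
proof (intro allI impI ballI)
  fix t :: nat and d
  assume t: "log 2 (real n - 1) - log 2 \<epsilon> \<le> real t" and d: "d \<in> decks n"
  have "log 2 ((real n - 1) / \<epsilon>) \<le> real t"
    using t assms by (simp add: log_divide)
  then have "(real n - 1) / \<epsilon> \<le> 2 ^ t"
    using assms by (simp add: log_le_iff powr_realpow)
  then have small: "(real n - 1) * (1 / 2 ^ t) \<le> \<epsilon>"
    using assms by (simp add: field_simps)
  have "tv_dist (map_pmf top_card (inverse_riffle n t d)) (pmf_of_set {1..n})
      \<le> real (card {1..n} - 1) * (1 / 2 ^ t)"
    using assms set_pmf_top_card[OF d] pmf_top_card_near_uniform[OF d]
    by (intro tv_dist_le_if_pmf_close) auto
  then show "tv_dist (map_pmf top_card (inverse_riffle n t d)) (stationary_distribution n top_card) \<le> \<epsilon>"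
    using small assms by (simp add: stationary_top_card of_nat_diff)
qed

end
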